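(* Let $X$ and $Y$ be proper geodesic metric spaces with base points $\mathfrak{o}_X$, $\mathfrak{o}_Y$, and let $\Phi\colon X\to Y$ be a quasi-isometry with $\Phi(\mathfrak{o}_X)=\mathfrak{o}_Y$. Then the map $$\Phi^*\colon P(X)\to P(Y),\qquad \Phi^*([\alpha])=[\Phi\circ\alpha],$$ is a well-defined bijection, and it preserves the partial order: $[\alpha]\preceq[\beta]$ in $P(X)$ if and only if $\Phi^*([\alpha])\preceq\Phi^*([\beta])$ in $P(Y)$.
   Context: Let $(X,d)$ be a proper geodesic metric space with a fixed base point $\mathfrak{o}$, and write $\|x\|=d(\mathfrak{o},x)$. Pairs of constants are written $\mathsf{q}=(q,Q)\in[1,\infty)\times[0,\infty)$. A $\mathsf{q}$-quasi-geodesic is a map $\alpha\colon I\to X$, $I\subset\mathbb{R}$ an interval, with $\frac{|t-s|}{q}-Q\le d(\alpha(s),\alpha(t))\le q|t-s|$ for all $s,t\in I$ (in particular $\alpha$ is Lipschitz and continuous). A $\mathsf{q}$-ray is a $\mathsf{q}$-quasi-geodesic $\alpha\colon[0,\infty)\to X$ with $\alpha(0)=\mathfrak{o}$; a quasi-geodesic ray is a $\mathsf{q}$-ray for some $\mathsf{q}$. For $r>0$, $t_r$ denotes the first time with $\|\alpha(t_r)\|\ge r$, and $\alpha|_r$ is the restriction of $\alpha$ to $[0,t_r]$. A ray $\gamma$ eventually coincides with $\beta$ if there are $t_\gamma>0$ and $t_\beta\in\mathbb{R}$ with $\gamma(t)=\beta(t+t_\beta)$ for all $t\ge t_\gamma$.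 The ray $\alpha$ can be $\mathsf{q}$-redirected to $\beta$ at radius $r$ if there is a $\mathsf{q}$-ray $\gamma$ with $\gamma|_r=\alpha|_r$ that eventually coincides with $\beta$. Write $\alpha\preceq\beta$ if there is $\mathsf{q}$ such that for every $r>0$, $\alpha$ can be $\mathsf{q}$-redirected to $\beta$ at radius $r$. This is a preorder; $\alpha\simeq\beta$ means $\alpha\preceq\beta$ and $\beta\preceq\alpha$. $P(X)$ is the set of equivalence classes $[\alpha]$, with the partial order $[\alpha]\preceq[\beta]$ iff $\alpha\preceq\beta$. A quasi-isometry $\Phi\colon X\to Y$ is a map such that for some $k\ge1,K\ge0$: $\frac1k d_X(x,x')-K\le d_Y(\Phi(x),\Phi(x'))\le k\,d_X(x,x')+K$ for all $x,x'$ and every point of $Y$ is within $K$ of $\Phi(X)$. Since $\Phi\circ\alpha$ need not be continuous, $[\Phi\circ\alpha]$ means the class of a quasi-geodesic ray $\alpha'\colon[0,\infty)\to Y$ (that is, a map for which there is $(q',Q')\in[1,\infty)\times[0,\infty)$ with $\frac{|t-s|}{q'}-Q'\le d_Y(\alpha'(s),\alpha'(t))\le q'|t-s|$ for all $s,t\ge0$) starting at $\mathfrak{o}_Y$ with $\sup_t d_Y(\alpha'(t),\Phi(\alpha(t)))<\infty$ (a "taming" of $\Phi\circ\alpha$, which always exists). *)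

theory Defs
  imports "HOL-Analysis.Analysis"
begin

definition geodesic_space :: "'a::metric_space set \<Rightarrow> bool" where
  "geodesic_space S \<longleftrightarrow>
     (\<forall>x\<in>S. \<forall>y\<in>S. \<exists>g. g ` {0..dist x y} \<subseteq> S \<and> g 0 = x \<and> g (dist x y) = y \<and>
        (\<forall>s\<in>{0..dist x y}. \<forall>t\<in>{0..dist x y}. dist (g s) (g t) = \<bar>s - t\<bar>))"

definition quasi_geodesic :: "real \<Rightarrow> real \<Rightarrow> real set \<Rightarrow> (real \<Rightarrow> 'a::metric_space) \<Rightarrow> bool" where
  "quasi_geodesic q Q I \<alpha> \<longleftrightarrow> 1 \<le> q \<and> 0 \<le> Q \<and> is_interval I \<and>
     (\<forall>s\<in>I. \<forall>t\<in>I. \<bar>t - s\<bar> / q - Q \<le> dist (\<alpha> s) (\<alpha> t) \<and> dist (\<alpha> s) (\<alpha> t) \<le> q * \<bar>t - s\<bar>)"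

text \<open>
  A map on the half-line is represented by a total function on the reals, of which only the values
  on \<open>{0..}\<close> matter. Two functions that agree on \<open>{0..}\<close> lie in the same class
  below, so the unused values do not affect the set of classes.
\<close>

definition q_ray :: "'a::metric_space \<Rightarrow> real \<Rightarrow> real \<Rightarrow> (real \<Rightarrow> 'a) \<Rightarrow> bool" where
  "q_ray x0 q Q \<alpha> \<longleftrightarrow> quasi_geodesic q Q {0..} \<alpha> \<and> \<alpha> 0 = x0"

definition qg_rays :: "'a::metric_space \<Rightarrow> (real \<Rightarrow> 'a) set" where
  "qg_rays x0 = {\<alpha>. \<exists>q Q. q_ray x0 q Q \<alpha>}"

text \<open>For a ray the least time exists, since rays are continuous and unbounded.\<close>

definition first_time :: "'a::metric_space \<Rightarrow> (real \<Rightarrow> 'a) \<Rightarrow> real \<Rightarrow> real" where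
  "first_time x0 \<alpha> r = (LEAST t. 0 \<le> t \<and> r \<le> dist x0 (\<alpha> t))"

text \<open>Equality of two restrictions as maps, hence including equality of their domains.\<close>

definition same_upto :: "'a::metric_space \<Rightarrow> real \<Rightarrow> (real \<Rightarrow> 'a) \<Rightarrow> (real \<Rightarrow> 'a) \<Rightarrow> bool" where
  "same_upto x0 r \<gamma> \<alpha> \<longleftrightarrow> first_time x0 \<gamma> r = first_time x0 \<alpha> r \<and>
     (\<forall>t\<in>{0..first_time x0 \<alpha> r}. \<gamma> t = \<alpha> t)"

text \<open>The condition \<open>0 \<le> t\<^sub>\<gamma> + t\<^sub>\<beta>\<close> says that \<open>\<beta>\<close> is only evaluated on the half-line.\<close>

definition eventually_coincides :: "(real \<Rightarrow> 'a) \<Rightarrow> (real \<Rightarrow> 'a) \<Rightarrow> bool" where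
  "eventually_coincides \<gamma> \<beta> \<longleftrightarrow>
     (\<exists>t\<^sub>\<gamma>>0. \<exists>t\<^sub>\<beta>. 0 \<le> t\<^sub>\<gamma> + t\<^sub>\<beta> \<and> (\<forall>t\<ge>t\<^sub>\<gamma>. \<gamma> t = \<beta> (t + t\<^sub>\<beta>)))"

definition redirectable ::
  "'a::metric_space \<Rightarrow> real \<Rightarrow> real \<Rightarrow> real \<Rightarrow> (real \<Rightarrow> 'a) \<Rightarrow> (real \<Rightarrow> 'a) \<Rightarrow> bool" where
  "redirectable x0 q Q r \<alpha> \<beta> \<longleftrightarrow>
     (\<exists>\<gamma>. q_ray x0 q Q \<gamma> \<and> same_upto x0 r \<gamma> \<alpha> \<and> eventually_coincides \<gamma> \<beta>)"

definition redirects :: "'a::metric_space \<Rightarrow> (real \<Rightarrow> 'a) \<Rightarrow> (real \<Rightarrow> 'a) \<Rightarrow> bool" where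
  "redirects x0 \<alpha> \<beta> \<longleftrightarrow> (\<exists>q\<ge>1. \<exists>Q\<ge>0. \<forall>r>0. redirectable x0 q Q r \<alpha> \<beta>)"

definition redirect_equiv :: "'a::metric_space \<Rightarrow> ((real \<Rightarrow> 'a) \<times> (real \<Rightarrow> 'a)) set" where
  "redirect_equiv x0 = {(\<alpha>, \<beta>). \<alpha> \<in> qg_rays x0 \<and> \<beta> \<in> qg_rays x0 \<and>
     redirects x0 \<alpha> \<beta> \<and> redirects x0 \<beta> \<alpha>}"

definition redirect_class :: "'a::metric_space \<Rightarrow> (real \<Rightarrow> 'a) \<Rightarrow> (real \<Rightarrow> 'a) set" where
  "redirect_class x0 \<alpha> = redirect_equiv x0 `` {\<alpha>}"

definition redirect_poset :: "'a::metric_space \<Rightarrow> (real \<Rightarrow> 'a) set set" where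
  "redirect_poset x0 = qg_rays x0 // redirect_equiv x0"

text \<open>As \<open>redirects\<close> is a preorder on rays, the choice of representatives is immaterial.\<close>

definition class_le :: "'a::metric_space \<Rightarrow> (real \<Rightarrow> 'a) set \<Rightarrow> (real \<Rightarrow> 'a) set \<Rightarrow> bool" where
  "class_le x0 A B \<longleftrightarrow> (\<exists>\<alpha>\<in>A. \<exists>\<beta>\<in>B. redirects x0 \<alpha> \<beta>)"

definition quasi_isometry :: "('a::metric_space \<Rightarrow> 'b::metric_space) \<Rightarrow> bool" where
  "quasi_isometry \<Phi> \<longleftrightarrow> (\<exists>k\<ge>1. \<exists>K\<ge>0.
     (\<forall>x x'. 1 / k * dist x x' - K \<le> dist (\<Phi> x) (\<Phi> x') \<and> dist (\<Phi> x) (\<Phi> x') \<le> k * dist x x' + K) \<and>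
     (\<forall>y. \<exists>x. dist y (\<Phi> x) \<le> K))"

definition taming ::
  "'b::metric_space \<Rightarrow> ('a \<Rightarrow> 'b) \<Rightarrow> (real \<Rightarrow> 'a) \<Rightarrow> (real \<Rightarrow> 'b) \<Rightarrow> bool" where
  "taming y0 \<Phi> \<alpha> \<alpha>' \<longleftrightarrow> \<alpha>' \<in> qg_rays y0 \<and> bdd_above ((\<lambda>t. dist (\<alpha>' t) (\<Phi> (\<alpha> t))) ` {0..})"

text \<open>
  The description is meaningful only if the class on the right depends neither on the
  representative nor on its taming, i.e. if the induced map is well defined; this is to be proved
  wherever the map is used.
\<close>

definition induced_map ::
  "'b::metric_space \<Rightarrow> ('a::metric_space \<Rightarrow> 'b) \<Rightarrow> (real \<Rightarrow> 'a) set \<Rightarrow> (real \<Rightarrow> 'b) set" where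
  "induced_map y0 \<Phi> A = (THE B. \<exists>\<alpha>\<in>A. \<exists>\<alpha>'. taming y0 \<Phi> \<alpha> \<alpha>' \<and> B = redirect_class y0 \<alpha>')"

end

theory Submission
  imports Defs
begin

text \<open>
  Suppose that a ray \<open>\<alpha>'\<close> fellow-travels \<open>\<Phi> \<circ> \<alpha>\<close>, that \<open>\<beta>'\<close> fellow-travels \<open>\<Phi> \<circ> \<beta>\<close>, and that \<open>\<gamma>\<close>
  redirects \<open>\<alpha>\<close> to \<open>\<beta>\<close> at a large radius. Follow \<open>\<alpha>'\<close> for a while, then a taming of \<open>\<Phi> \<circ> \<gamma>\<close>, then
  \<open>\<beta>'\<close>, passing from each to the next along a geodesic traversed in unit time. The result is
  Lipschitz and stays uniformly close to \<open>\<Phi> \<circ> \<gamma>\<close>, so it is a quasi-geodesic with constants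
  independent of the radius, and it redirects \<open>\<alpha>'\<close> to \<open>\<beta>'\<close>. This uses neither the coarse
  surjectivity of \<open>\<Phi>\<close> nor the base points, so it also applies to a quasi-inverse of \<open>\<Phi>\<close>, which gives
  the converse implication and surjectivity.
\<close>

section \<open>Lipschitz paths in geodesic spaces\<close>

text \<open>Rescaling to unit time turns the distance of the endpoints into the Lipschitz constant
  and covers x = y without a case distinction.\<close>

lemma geodesic_space_unit_path:
  fixes x y :: "'a::metric_space"
  assumes "geodesic_space (UNIV :: 'a set)"
  obtains h :: "real \<Rightarrow> 'a" where "h 0 = x" "h 1 = y" "(dist x y)-lipschitz_on {0..1} h"
proof -
  obtain g where g: "g 0 = x" "g (dist x y) = y"
    "\<And>s t. s \<in> {0..dist x y} \<Longrightarrow> t \<in> {0..dist x y} \<Longrightarrow> dist (g s) (g t) = \<bar>s - t\<bar>"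
    using assms[unfolded geodesic_space_def, rule_format, of x y] by auto
  define h where "h = (\<lambda>u. g (u * dist x y))"
  have "dist (h u) (h v) \<le> dist x y * dist u v" if "u \<in> {0..1}" "v \<in> {0..1}" for u v
  proof -
    have "u * dist x y \<in> {0..dist x y}" "v * dist x y \<in> {0..dist x y}"
      using that by (auto intro: mult_left_le_one_le)
    then have "dist (h u) (h v) = \<bar>u * dist x y - v * dist x y\<bar>"
      unfolding h_def by (rule g(3))
    also have "\<dots> = dist x y * dist u v"
      by (simp add: dist_real_def abs_mult flip: left_diff_distrib)
    finally show ?thesis by simp
  qed
  then have "(dist x y)-lipschitz_on {0..1} h"
    by (auto intro: lipschitz_onI)
  then show thesis
    using that[of h] g(1,2) by (simp add: h_def)
qed

text \<open>For s \<le> c \<le> t the lengths |s - c| and |c - t| add up to |s - t|, so passing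
  through \<open>c\<close> does not enlarge the constant.\<close>

lemma lipschitz_on_split:
  fixes f :: "real \<Rightarrow> 'a::metric_space"
  assumes 1: "L-lipschitz_on (A \<inter> {..c}) f" and 2: "L-lipschitz_on (A \<inter> {c..}) f" and "c \<in> A"
  shows "L-lipschitz_on A f"
proof (rule lipschitz_onI)
  show L: "0 \<le> L" using 1 by (rule lipschitz_on_nonneg)
  have le: "dist (f s) (f t) \<le> L * dist s t" if "s \<in> A" "t \<in> A" "s \<le> t" for s t
  proof (cases "t \<le> c \<or> c \<le> s")
    case True
    then show ?thesis
      using that lipschitz_onD[OF 1, of s t] lipschitz_onD[OF 2, of s t] by auto
  next
    case False
    have "dist (f s) (f t) \<le> dist (f s) (f c) + dist (f c) (f t)"
      by (rule dist_triangle)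
    also have "\<dots> \<le> L * dist s c + L * dist c t"
      using that False \<open>c \<in> A\<close>
      by (intro add_mono lipschitz_onD[OF 1] lipschitz_onD[OF 2]) auto
    also have "\<dots> = L * dist s t"
      using False by (simp add: dist_real_def algebra_simps)
    finally show ?thesis .
  qed
  show "dist (f s) (f t) \<le> L * dist s t" if "s \<in> A" "t \<in> A" for s t
    using le[of s t] le[of t s] that by (cases "s \<le> t") (auto simp: dist_commute)
qed

lemma lipschitz_on_shift:
  fixes f :: "real \<Rightarrow> 'a::metric_space"
  assumes f: "L-lipschitz_on A f" and "\<And>t. t \<in> B \<Longrightarrow> t + b \<in> A"
  shows "L-lipschitz_on B (\<lambda>t. f (t + b))"
proof (rule lipschitz_onI)
  show "0 \<le> L" using f by (rule lipschitz_on_nonneg)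
  fix s t assume "s \<in> B" "t \<in> B"
  then show "dist (f (s + b)) (f (t + b)) \<le> L * dist s t"
    using lipschitz_onD[OF f, of "s + b" "t + b"] assms(2) by (simp add: dist_real_def)
qed

text \<open>The path between \<open>\<eta>1\<close> and \<open>\<eta>2\<close> ends at \<open>\<eta>2 (T + 1)\<close>, so that no time shift occurs.\<close>

lemma lipschitz_splice:
  fixes \<eta>1 \<eta>2 :: "real \<Rightarrow> 'a::metric_space"
  assumes geo: "geodesic_space (UNIV :: 'a set)"
    and 1: "L-lipschitz_on {0..T} \<eta>1" and 2: "L-lipschitz_on {T..} \<eta>2"
    and C: "dist (\<eta>1 T) (\<eta>2 T) \<le> C" and "0 \<le> T"
  obtains \<eta> where "(L + C)-lipschitz_on {0..} \<eta>"
    "\<And>t. t \<le> T \<Longrightarrow> \<eta> t = \<eta>1 t" "\<And>t. T + 1 \<le> t \<Longrightarrow> \<eta> t = \<eta>2 t"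
    "\<And>t. t \<in> {T..T+1} \<Longrightarrow> dist (\<eta> t) (\<eta>2 t) \<le> 2 * L + C"
proof -
  obtain h :: "real \<Rightarrow> 'a" where h: "h 0 = \<eta>1 T" "h 1 = \<eta>2 (T + 1)"
    "(dist (\<eta>1 T) (\<eta>2 (T + 1)))-lipschitz_on {0..1} h"
    by (rule geodesic_space_unit_path[OF geo, of "\<eta>1 T" "\<eta>2 (T + 1)"])
  define \<eta> where "\<eta> = (\<lambda>t. if t \<le> T then \<eta>1 t else if t \<le> T + 1 then h (t - T) else \<eta>2 t)"
  have L: "0 \<le> L" using 1 by (rule lipschitz_on_nonneg)
  have C0: "0 \<le> C" by (rule order_trans[OF zero_le_dist C])
  have mid: "\<eta> t = h (t - T)" if "t \<in> {T..T+1}" for t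
    using that h(1) by (cases "t = T") (auto simp: \<eta>_def)
  have tail: "\<eta> t = \<eta>2 t" if "T + 1 \<le> t" for t
    using that h(2) by (cases "t = T + 1") (auto simp: \<eta>_def)
  \<comment> \<open>The bridge covers the gap \<open>C\<close> at time \<open>T\<close> and the
    distance, at most \<open>L\<close>, that \<open>\<eta>2\<close> moves meanwhile.\<close>
  have "dist (\<eta>1 T) (\<eta>2 (T + 1)) \<le> dist (\<eta>1 T) (\<eta>2 T) + dist (\<eta>2 T) (\<eta>2 (T + 1))"
    by (rule dist_triangle)
  also have "\<dots> \<le> L + C"
    using C lipschitz_onD[OF 2, of T "T + 1"] by (simp add: dist_real_def)
  finally have "(L + C)-lipschitz_on {0..1} h"
    by (rule lipschitz_on_le[OF h(3)])
  from lipschitz_on_shift[OF this, of "{T..T+1}" "-T"]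
  have lip_mid: "(L + C)-lipschitz_on {T..T+1} \<eta>"
    using mid by (auto simp: lipschitz_on_def)
  have "(L + C)-lipschitz_on {T+1..} \<eta>"
    using lipschitz_on_subset[OF lipschitz_on_le[OF 2, of "L + C"], of "{T+1..}"] tail C0
    by (auto simp: lipschitz_on_def)
  moreover have "{T..} \<inter> {..T+1} = {T..T+1}" "{T..} \<inter> {T+1..} = {T+1..}" by auto
  ultimately have "(L + C)-lipschitz_on {T..} \<eta>"
    using lip_mid by (intro lipschitz_on_split[of _ "{T..}" "T + 1"]) auto
  moreover have "(L + C)-lipschitz_on {0..T} \<eta>"
    using lipschitz_on_le[OF 1, of "L + C"] C0 by (auto simp: lipschitz_on_def \<eta>_def)
  moreover have "{0..} \<inter> {..T} = {0..T}" "{0..} \<inter> {T..} = {T..}"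
    using \<open>0 \<le> T\<close> by auto
  ultimately have lip: "(L + C)-lipschitz_on {0..} \<eta>"
    using \<open>0 \<le> T\<close> by (intro lipschitz_on_split[of _ "{0..}" T]) auto
  \<comment> \<open>Both paths are compared with their common value at time
    \<open>T + 1\<close>.\<close>
  have close: "dist (\<eta> t) (\<eta>2 t) \<le> 2 * L + C" if t: "t \<in> {T..T+1}" for t
  proof -
    have "dist (\<eta> t) (\<eta>2 t) \<le> dist (\<eta> t) (\<eta> (T + 1)) + dist (\<eta>2 (T + 1)) (\<eta>2 t)"
      using tail[of "T + 1"] dist_triangle[of "\<eta> t" "\<eta>2 t" "\<eta>2 (T + 1)"] by simp
    also have "\<dots> \<le> (L + C) * dist t (T + 1) + L * dist (T + 1) t"
      using t by (intro add_mono lipschitz_onD[OF lip_mid] lipschitz_onD[OF 2]) auto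
    also have "\<dots> \<le> (L + C) * 1 + L * 1"
      using t L C0 by (intro add_mono mult_left_mono) (auto simp: dist_real_def)
    finally show ?thesis by simp
  qed
  show thesis
    by (rule that[OF lip _ tail close]) (auto simp: \<eta>_def)
qed

text \<open>Values of \<open>f\<close> at consecutive integers are at most \<open>L + M\<close>
  apart; unit-time paths join them. Since \<open>\<eta>\<close> and \<open>f\<close> agree at
  integers and each moves by at most \<open>L + M\<close> within a unit of time, the error is twice
  that.\<close>

lemma coarse_lipschitz_approx:
  fixes f :: "real \<Rightarrow> 'a::metric_space"
  assumes geo: "geodesic_space (UNIV :: 'a set)"
    and f: "\<And>s t. 0 \<le> s \<Longrightarrow> 0 \<le> t \<Longrightarrow> dist (f s) (f t) \<le> L * \<bar>s - t\<bar> + M"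
    and "0 \<le> L" "0 \<le> M"
  obtains \<eta> where "\<eta> 0 = f 0" "(L + M)-lipschitz_on {0..} \<eta>"
    "\<And>t. 0 \<le> t \<Longrightarrow> dist (\<eta> t) (f t) \<le> 2 * (L + M)"
proof -
  have "\<exists>h :: real \<Rightarrow> 'a. h 0 = f (real n) \<and> h 1 = f (real n + 1) \<and> (L + M)-lipschitz_on {0..1} h" for n
  proof -
    obtain h :: "real \<Rightarrow> 'a" where h: "h 0 = f (real n)" "h 1 = f (real n + 1)"
      "(dist (f (real n)) (f (real n + 1)))-lipschitz_on {0..1} h"
      by (rule geodesic_space_unit_path[OF geo, of "f (real n)" "f (real n + 1)"])
    moreover have "dist (f (real n)) (f (real n + 1)) \<le> L + M"
      using f[of "real n" "real n + 1"] by simp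
    ultimately show ?thesis by (meson lipschitz_on_le)
  qed
  then obtain h :: "nat \<Rightarrow> real \<Rightarrow> 'a" where h: "\<And>n. h n 0 = f (real n)" "\<And>n. h n 1 = f (real n + 1)"
    "\<And>n. (L + M)-lipschitz_on {0..1} (h n)"
    by metis
  define \<eta> where "\<eta> = (\<lambda>t. h (nat \<lfloor>t\<rfloor>) (t - real (nat \<lfloor>t\<rfloor>)))"
  \<comment> \<open>Gluing requires the closed interval. At its right end the floor has already
    jumped to \<open>Suc n\<close>, but \<open>h n\<close> ends where \<open>h (Suc n)\<close>
    starts.\<close>
  have eq: "\<eta> t = h n (t - real n)" if "real n \<le> t" "t \<le> real n + 1" for n t
  proof (cases "t = real n + 1")
    case True
    then have "nat \<lfloor>t\<rfloor> = Suc n" by linarith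
    then show ?thesis using True h(1)[of "Suc n"] h(2)[of n] by (simp add: \<eta>_def add.commute)
  next
    case False
    then have "nat \<lfloor>t\<rfloor> = n" using that by linarith
    then show ?thesis by (simp add: \<eta>_def)
  qed
  have piece: "(L + M)-lipschitz_on {real n..real n + 1} \<eta>" for n
    using lipschitz_on_shift[OF h(3)[of n], of "{real n..real n + 1}" "- real n"] eq[of n]
    by (auto simp: lipschitz_on_def)
  have upto: "(L + M)-lipschitz_on {0..real n} \<eta>" for n
  proof (induction n)
    case 0
    then show ?case using \<open>0 \<le> L\<close> \<open>0 \<le> M\<close> by (auto simp: lipschitz_on_def)
  next
    case (Suc n)
    have "{0..real (Suc n)} \<inter> {..real n} = {0..real n}"
      "{0..real (Suc n)} \<inter> {real n..} = {real n..real n + 1}" by auto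
    then show ?case
      using Suc piece[of n] by (intro lipschitz_on_split[of _ "{0..real (Suc n)}" "real n"]) (auto simp: add.commute[of 1])
  qed
  \<comment> \<open>Any two times lie in a common interval \<open>{0..real n}\<close>, and the
    constant in \<open>upto\<close> is the same for all \<open>n\<close>.\<close>
  have lip: "(L + M)-lipschitz_on {0..} \<eta>"
  proof (rule lipschitz_onI)
    show "0 \<le> L + M" using \<open>0 \<le> L\<close> \<open>0 \<le> M\<close> by simp
    fix s t :: real assume "s \<in> {0..}" "t \<in> {0..}"
    moreover obtain n where "max s t \<le> real n" using real_arch_simple by blast
    ultimately show "dist (\<eta> s) (\<eta> t) \<le> (L + M) * dist s t"
      by (intro lipschitz_onD[OF upto[of n]]) auto
  qed
  have close: "dist (\<eta> t) (f t) \<le> 2 * (L + M)" if "0 \<le> t" for t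
  proof -
    define n where "n = nat \<lfloor>t\<rfloor>"
    have n: "real n \<le> t" "t \<le> real n + 1" using that by (auto simp: n_def)
    have "\<eta> (real n) = f (real n)" using eq[of n "real n"] h(1) by simp
    then have "dist (\<eta> t) (f t) \<le> dist (\<eta> t) (\<eta> (real n)) + dist (f (real n)) (f t)"
      by (metis dist_triangle)
    also have "\<dots> \<le> (L + M) * dist t (real n) + (L * \<bar>real n - t\<bar> + M)"
      using that by (intro add_mono lipschitz_onD[OF lip] f) auto
    also have "\<dots> \<le> (L + M) * 1 + (L * 1 + M)"
      using n \<open>0 \<le> L\<close> \<open>0 \<le> M\<close> by (intro add_mono mult_left_mono) (auto simp: dist_real_def)
    finally show ?thesis by simp
  qed
  show thesis
    using that[of \<eta>] lip close eq[of 0 0] h(1)[of 0] by simp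
qed

section \<open>Quasi-geodesic rays\<close>

text \<open>The upper bound becomes a Lipschitz condition, to which the gluing lemmas apply; by
  symmetry of the distance, ordered pairs of times suffice for the lower bound.\<close>

lemma q_ray_iff:
  "q_ray x0 q Q \<alpha> \<longleftrightarrow> 1 \<le> q \<and> 0 \<le> Q \<and> \<alpha> 0 = x0 \<and> q-lipschitz_on {0..} \<alpha> \<and>
     (\<forall>s t. 0 \<le> s \<longrightarrow> s \<le> t \<longrightarrow> (t - s) / q - Q \<le> dist (\<alpha> s) (\<alpha> t))"
  (is "?l \<longleftrightarrow> ?r")
proof
  assume l: ?l
  have "(t - s) / q - Q \<le> dist (\<alpha> s) (\<alpha> t)" if "0 \<le> s" "s \<le> t" for s t
  proof -
    have "\<bar>t - s\<bar> / q - Q \<le> dist (\<alpha> s) (\<alpha> t)"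
      using l that unfolding q_ray_def quasi_geodesic_def by (meson atLeast_iff order_trans)
    then show ?thesis using that by simp
  qed
  with l show ?r
    by (auto simp: q_ray_def quasi_geodesic_def lipschitz_on_def dist_real_def abs_minus_commute)
next
  assume r: ?r
  have "\<bar>t - s\<bar> / q - Q \<le> dist (\<alpha> s) (\<alpha> t)" if "0 \<le> s" "0 \<le> t" for s t
    using r that by (cases "s \<le> t") (auto simp: dist_commute)
  with r show ?l
    by (auto simp: q_ray_def quasi_geodesic_def lipschitz_on_def dist_real_def abs_minus_commute
        is_interval_ci)
qed

lemma q_ray_lower:
  assumes "q_ray x0 q Q \<alpha>" "0 \<le> s" "s \<le> t"
  shows "(t - s) / q - Q \<le> dist (\<alpha> s) (\<alpha> t)"
  using assms by (simp add: q_ray_iff)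

lemma q_ray_dist_base_ge:
  assumes "q_ray x0 q Q \<alpha>" "0 \<le> t"
  shows "t / q - Q \<le> dist x0 (\<alpha> t)"
  using assms by (force simp: q_ray_iff)

lemma q_ray_dist_base_le:
  assumes "q_ray x0 q Q \<alpha>" "0 \<le> t"
  shows "dist x0 (\<alpha> t) \<le> q * t"
  using assms lipschitz_onD[of q "{0..}" \<alpha> 0 t] by (auto simp: q_ray_iff dist_real_def)

section \<open>First exit times and agreement up to a radius\<close>

lemma first_time_eqI:
  assumes "0 \<le> u" "r \<le> dist x0 (\<alpha> u)" "\<And>t. 0 \<le> t \<Longrightarrow> r \<le> dist x0 (\<alpha> t) \<Longrightarrow> u \<le> t"
  shows "first_time x0 \<alpha> r = u"
  unfolding first_time_def using assms by (intro Least_equality) auto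

text \<open>The times at distance at least \<open>r\<close> form a closed set by continuity,
  non-empty by the linear lower bound, so the infimum is attained.\<close>

lemma first_time:
  assumes "q_ray x0 q Q \<alpha>"
  shows "0 \<le> first_time x0 \<alpha> r" "r \<le> dist x0 (\<alpha> (first_time x0 \<alpha> r))"
    "\<And>t. 0 \<le> t \<Longrightarrow> r \<le> dist x0 (\<alpha> t) \<Longrightarrow> first_time x0 \<alpha> r \<le> t"
proof -
  define S where "S = {t \<in> {0..}. r \<le> dist x0 (\<alpha> t)}"
  have "continuous_on {0..} \<alpha>"
    using assms by (auto simp: q_ray_iff intro: lipschitz_on_continuous_on)
  then have "closed S"
    unfolding S_def by (intro continuous_on_closed_Collect_le continuous_intros) auto
  moreover have "S \<noteq> {}"
  proof -
    have q: "1 \<le> q" "0 \<le> Q" using assms by (auto simp: q_ray_iff)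
    \<comment> \<open>This time solves t / q - Q = |r|; the absolute value keeps it nonnegative for
      negative \<open>r\<close>.\<close>
    have "(q * (\<bar>r\<bar> + Q)) / q - Q \<le> dist x0 (\<alpha> (q * (\<bar>r\<bar> + Q)))"
      using q by (intro q_ray_dist_base_ge[OF assms]) auto
    then have "q * (\<bar>r\<bar> + Q) \<in> S" using q by (simp add: S_def)
    then show ?thesis by blast
  qed
  moreover have bdd: "bdd_below S" by (auto simp: S_def bdd_below_def)
  ultimately have "Inf S \<in> S" by (intro closed_contains_Inf)
  moreover have "Inf S \<le> t" if "t \<in> S" for t using that bdd by (rule cInf_lower)
  ultimately have mem: "0 \<le> Inf S" "r \<le> dist x0 (\<alpha> (Inf S))"
    "\<And>t. 0 \<le> t \<Longrightarrow> r \<le> dist x0 (\<alpha> t) \<Longrightarrow> Inf S \<le> t"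
    by (auto simp: S_def)
  then have "first_time x0 \<alpha> r = Inf S" by (rule first_time_eqI)
  with mem show "0 \<le> first_time x0 \<alpha> r" "r \<le> dist x0 (\<alpha> (first_time x0 \<alpha> r))"
    "\<And>t. 0 \<le> t \<Longrightarrow> r \<le> dist x0 (\<alpha> t) \<Longrightarrow> first_time x0 \<alpha> r \<le> t"
    by simp_all
qed

text \<open>A time before \<open>T\<close> at which \<open>\<gamma>\<close> is at distance
  \<open>r\<close> is also one for \<open>\<alpha>\<close>, and times after \<open>T\<close> are too
  late to be first; hence the first times agree although nothing is assumed about
  \<open>\<gamma>\<close> beyond \<open>T\<close>.\<close>

lemma same_uptoI:
  assumes \<alpha>: "q_ray x0 q Q \<alpha>" and eq: "\<And>t. 0 \<le> t \<Longrightarrow> t \<le> T \<Longrightarrow> \<gamma> t = \<alpha> t"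
    and T: "first_time x0 \<alpha> r \<le> T"
  shows "same_upto x0 r \<gamma> \<alpha>"
proof -
  have "first_time x0 \<gamma> r = first_time x0 \<alpha> r"
  proof (rule first_time_eqI)
    fix t assume t: "0 \<le> t" "r \<le> dist x0 (\<gamma> t)"
    then show "first_time x0 \<alpha> r \<le> t"
      using first_time(3)[OF \<alpha>, of t r] eq[of t] T by (cases "t \<le> T") auto
  qed (use first_time(1,2)[OF \<alpha>, of r] eq[of "first_time x0 \<alpha> r"] T in auto)
  then show ?thesis using eq T by (auto simp: same_upto_def)
qed

text \<open>A \<open>q\<close>-Lipschitz ray cannot reach distance \<open>r\<close> before time r /
  q. This converts a large radius into a long time of agreement.\<close>

lemma same_uptoD:
  assumes \<alpha>: "q_ray x0 q Q \<alpha>" and "same_upto x0 r \<gamma> \<alpha>" and "0 \<le> t" "q * t \<le> r"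
  shows "\<gamma> t = \<alpha> t"
proof -
  let ?u = "first_time x0 \<alpha> r"
  have "q * t \<le> q * ?u"
    using first_time(1,2)[OF \<alpha>, of r] q_ray_dist_base_le[OF \<alpha>, of ?u] assms(4) by simp
  then have "t \<le> ?u" using \<alpha> by (auto simp: q_ray_iff)
  then show ?thesis using assms(2,3) by (auto simp: same_upto_def)
qed

section \<open>Redirection is a preorder\<close>

lemma redirects_refl:
  assumes "\<alpha> \<in> qg_rays x0"
  shows "redirects x0 \<alpha> \<alpha>"
proof -
  obtain q Q where q: "q_ray x0 q Q \<alpha>" using assms by (auto simp: qg_rays_def)
  moreover have "same_upto x0 r \<alpha> \<alpha>" for r by (simp add: same_upto_def)
  moreover have "eventually_coincides \<alpha> \<alpha>"
    unfolding eventually_coincides_def by (rule exI[of _ 1], simp, rule exI[of _ 0], simp)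
  ultimately show ?thesis
    unfolding redirects_def redirectable_def by (meson q_ray_iff)
qed

text \<open>
  Let \<open>\<gamma>\<close> redirect \<open>\<alpha>\<close> to \<open>\<beta>\<close>. If \<open>\<gamma>2\<close> leaves \<open>\<beta>\<close> for \<open>\<delta>\<close> only at a radius that is very large compared
  with the part of \<open>\<gamma>\<close> before it joins \<open>\<beta>\<close>, then switching from \<open>\<gamma>\<close> to \<open>\<gamma>2\<close> along \<open>\<beta>\<close> gives a
  quasi-geodesic: distances from the early part to the late part are almost distances from the
  base point.
\<close>

lemma redirects_trans:
  assumes \<alpha>: "\<alpha> \<in> qg_rays x0" and \<beta>: "\<beta> \<in> qg_rays x0"
    and "redirects x0 \<alpha> \<beta>" "redirects x0 \<beta> \<delta>"
  shows "redirects x0 \<alpha> \<delta>"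
proof -
  obtain qa Qa where \<alpha>: "q_ray x0 qa Qa \<alpha>" using assms(1) by (auto simp: qg_rays_def)
  obtain qb Qb where \<beta>: "q_ray x0 qb Qb \<beta>" using assms(2) by (auto simp: qg_rays_def)
  obtain q1 Q1 where q1: "1 \<le> q1" "0 \<le> Q1" and
    1: "\<And>r. 0 < r \<Longrightarrow> redirectable x0 q1 Q1 r \<alpha> \<beta>"
    using assms(3) by (auto simp: redirects_def)
  obtain q2 Q2 where q2: "1 \<le> q2" "0 \<le> Q2" and
    2: "\<And>r. 0 < r \<Longrightarrow> redirectable x0 q2 Q2 r \<beta> \<delta>"
    using assms(4) by (auto simp: redirects_def)
  \<comment> \<open>The summand \<open>q1\<close> serves pairs of early times, \<open>2 * q2\<close>
    the late and the mixed pairs; the radius does not enter.\<close>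
  define q where "q = q1 + 2 * q2"
  define Q where "Q = Q1 + Q2"
  have q_le: "1 \<le> q" "q1 \<le> q" "q2 \<le> q" "2 * q2 \<le> q" using q1 q2 by (auto simp: q_def)
  have Q_le: "0 \<le> Q" "Q1 \<le> Q" "Q2 \<le> Q" using q1 q2 by (auto simp: Q_def)
  have "redirectable x0 q Q r \<alpha> \<delta>" if r: "0 < r" for r
  proof -
    obtain \<gamma> t0 b where \<gamma>: "q_ray x0 q1 Q1 \<gamma>" "same_upto x0 r \<gamma> \<alpha>"
      and t0: "0 < t0" "0 \<le> t0 + b" and \<gamma>\<beta>: "\<And>t. t0 \<le> t \<Longrightarrow> \<gamma> t = \<beta> (t + b)"
      using 1[OF r] by (auto simp: redirectable_def eventually_coincides_def)
    \<comment> \<open>From \<open>T\<close> on, \<open>\<gamma>\<close> follows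
      \<open>\<beta>\<close>, and the part of \<open>\<alpha>\<close> to be preserved is already
      over.\<close>
    define T where "T = max t0 (first_time x0 \<alpha> r)"
    have T: "0 < T" "0 \<le> T + b" "t0 \<le> T" "first_time x0 \<alpha> r \<le> T" using t0 by (auto simp: T_def)
    \<comment> \<open>Chosen so that t \<ge> W gives t \<le> 2 (t + b) - 2 q2 q1 T, which is what
      the mixed pairs below require.\<close>
    define W where "W = T + 2 * \<bar>b\<bar> + 2 * q2 * q1 * T"
    have W: "T \<le> W" using T q1 q2 by (simp add: W_def)
    \<comment> \<open>At this radius \<open>\<gamma>2\<close> agrees with \<open>\<beta>\<close> up
      to time \<open>W + b\<close>; the 1 makes the radius positive.\<close>
    have "0 < qb * (W + b) + 1"
      using W T \<beta> by (intro add_nonneg_pos mult_nonneg_nonneg) (auto simp: q_ray_iff)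
    then obtain \<gamma>2 t2 c where \<gamma>2: "q_ray x0 q2 Q2 \<gamma>2" "same_upto x0 (qb * (W + b) + 1) \<gamma>2 \<beta>"
      and t2: "0 < t2" "0 \<le> t2 + c" and \<gamma>2\<delta>: "\<And>t. t2 \<le> t \<Longrightarrow> \<gamma>2 t = \<delta> (t + c)"
      using 2 unfolding redirectable_def eventually_coincides_def by metis
    have \<beta>\<gamma>2: "\<gamma>2 (t + b) = \<gamma> t" if "T \<le> t" "t \<le> W" for t
    proof -
      have "qb * (t + b) \<le> qb * (W + b)"
        using that \<beta> by (intro mult_left_mono) (auto simp: q_ray_iff)
      then have "\<gamma>2 (t + b) = \<beta> (t + b)"
        using that T by (intro same_uptoD[OF \<beta> \<gamma>2(2)]) auto
      then show ?thesis using \<gamma>\<beta> that T by simp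
    qed
    define \<gamma>3 where "\<gamma>3 = (\<lambda>t. if t \<le> T then \<gamma> t else \<gamma>2 (t + b))"
    have early: "\<gamma>3 t = \<gamma> t" if "t \<le> W" for t
      using that \<beta>\<gamma>2 by (auto simp: \<gamma>3_def)
    have late: "\<gamma>3 t = \<gamma>2 (t + b)" if "T \<le> t" for t
      using that \<beta>\<gamma>2[of T] W by (cases "t = T") (auto simp: \<gamma>3_def)
    have lip\<gamma>: "q-lipschitz_on {0..} \<gamma>" "q-lipschitz_on {0..} \<gamma>2"
      using \<gamma>(1) \<gamma>2(1) lipschitz_on_le[OF _ q_le(2)] lipschitz_on_le[OF _ q_le(3)]
      by (auto simp: q_ray_iff)
    have "q-lipschitz_on ({0..} \<inter> {..T}) \<gamma>3"
      using lip\<gamma>(1) by (auto simp: lipschitz_on_def \<gamma>3_def)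
    moreover have "q-lipschitz_on ({0..} \<inter> {T..}) \<gamma>3"
      using lipschitz_on_shift[OF lip\<gamma>(2), of "{T..}" b] late T by (auto simp: lipschitz_on_def)
    ultimately have lip: "q-lipschitz_on {0..} \<gamma>3"
      using T by (intro lipschitz_on_split[of _ "{0..}" T]) auto
    have low: "(t - s) / q - Q \<le> dist (\<gamma>3 s) (\<gamma>3 t)" if st: "0 \<le> s" "s \<le> t" for s t
    proof -
      have weaken: "(t - s) / q - Q \<le> (t - s) / q' - Q'"
        if "1 \<le> q'" "q' \<le> q" "Q' \<le> Q" for q' Q'
        using that st by (intro diff_mono divide_left_mono) auto
      \<comment> \<open>On the window from \<open>T\<close> to \<open>W\<close> both descriptions of
        \<open>\<gamma>3\<close> hold, so only pairs that straddle the whole window mix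
        \<open>\<gamma>\<close> with \<open>\<gamma>2\<close>.\<close>
      consider "t \<le> W" | "T \<le> s" | "s \<le> T" "W \<le> t" by linarith
      then show ?thesis
      proof cases
        case 1
        then have "(t - s) / q1 - Q1 \<le> dist (\<gamma>3 s) (\<gamma>3 t)"
          using \<gamma>(1) st early by (auto simp: q_ray_iff)
        then show ?thesis using weaken[of q1 Q1] q1 q_le Q_le by linarith
      next
        case 2
        then have "(t - s) / q2 - Q2 \<le> dist (\<gamma>3 s) (\<gamma>3 t)"
          using st T q_ray_lower[OF \<gamma>2(1), of "s + b" "t + b"] by (simp add: late)
        then show ?thesis using weaken[of q2 Q2] q2 q_le Q_le by linarith
      next
        case 3
        \<comment> \<open>The early point stays within \<open>q1 * T\<close> of the base point, so
          the reverse triangle inequality bounds the distance by that of the late point from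
          \<open>x0\<close>.\<close>
        have "dist x0 (\<gamma> s) \<le> q1 * T"
          using q_ray_dist_base_le[OF \<gamma>(1), of s] mult_left_mono[of s T q1] st 3 q1 by linarith
        moreover have "(t + b) / q2 - Q2 \<le> dist x0 (\<gamma>2 (t + b))"
          using 3 W T by (intro q_ray_dist_base_ge[OF \<gamma>2(1)]) auto
        moreover have "dist x0 (\<gamma>2 (t + b)) \<le> dist x0 (\<gamma> s) + dist (\<gamma>3 s) (\<gamma>3 t)"
          using 3 W early[of s] late[of t] dist_triangle[of x0 "\<gamma>2 (t + b)" "\<gamma> s"] by simp
        moreover have "(t - s) / (2 * q2) \<le> (t + b) / q2 - q1 * T"
        proof -
          have "t - s \<le> 2 * (t + b) - 2 * q2 * q1 * T"
            using 3 T st by (simp add: W_def)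
          then have "(t - s) / (2 * q2) \<le> (2 * (t + b) - 2 * q2 * q1 * T) / (2 * q2)"
            using q2 by (intro divide_right_mono) auto
          then show ?thesis using q2 by (simp add: diff_divide_distrib add_divide_distrib)
        qed
        ultimately have "(t - s) / (2 * q2) - Q2 \<le> dist (\<gamma>3 s) (\<gamma>3 t)" by linarith
        then show ?thesis using weaken[of "2 * q2" Q2] q2 q_le Q_le by linarith
      qed
    qed
    have "q_ray x0 q Q \<gamma>3"
      using lip low q_le Q_le \<gamma>(1) T by (auto simp: q_ray_iff \<gamma>3_def)
    moreover have "same_upto x0 r \<gamma>3 \<alpha>"
    proof (rule same_uptoI[OF \<alpha> _ order_refl])
      fix t assume "0 \<le> t" "t \<le> first_time x0 \<alpha> r"
      then show "\<gamma>3 t = \<alpha> t" using \<gamma>(2) T by (auto simp: \<gamma>3_def same_upto_def)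
    qed
    moreover have "eventually_coincides \<gamma>3 \<delta>"
    proof -
      \<comment> \<open>After \<open>t3\<close> the path runs along \<open>\<gamma>2\<close>, at
        times \<open>t + b\<close> past \<open>t2\<close>; the shifts \<open>b\<close> and
        \<open>c\<close> add up.\<close>
      define t3 where "t3 = max T (t2 - b)"
      have "\<gamma>3 t = \<delta> (t + (b + c))" if "t3 \<le> t" for t
        using that late[of t] \<gamma>2\<delta>[of "t + b"] by (auto simp: t3_def add.assoc)
      moreover have "0 < t3" "0 \<le> t3 + (b + c)" using T t2 by (auto simp: t3_def)
      ultimately show ?thesis unfolding eventually_coincides_def by blast
    qed
    ultimately show ?thesis unfolding redirectable_def by blast
  qed
  then show ?thesis using q_le(1) Q_le(1) by (auto simp: redirects_def)
qed

section \<open>Equivalence classes of rays and their order\<close>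

lemma equiv_redirect_equiv: "equiv (qg_rays x0) (redirect_equiv x0)"
proof (rule equivI)
  show "redirect_equiv x0 \<subseteq> qg_rays x0 \<times> qg_rays x0" by (auto simp: redirect_equiv_def)
  show "refl_on (qg_rays x0) (redirect_equiv x0)"
    by (auto simp: refl_on_def redirect_equiv_def redirects_refl)
  show "sym (redirect_equiv x0)" by (auto simp: sym_def redirect_equiv_def)
  show "trans (redirect_equiv x0)"
    by (auto simp: trans_def redirect_equiv_def intro: redirects_trans)
qed

lemma redirect_class_eq_iff:
  assumes "\<alpha> \<in> qg_rays x0" "\<beta> \<in> qg_rays x0"
  shows "redirect_class x0 \<alpha> = redirect_class x0 \<beta> \<longleftrightarrow> redirects x0 \<alpha> \<beta> \<and> redirects x0 \<beta> \<alpha>"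
  using eq_equiv_class_iff[OF equiv_redirect_equiv assms] assms
  by (auto simp: redirect_class_def redirect_equiv_def)

lemma redirect_class_self: "\<alpha> \<in> qg_rays x0 \<Longrightarrow> \<alpha> \<in> redirect_class x0 \<alpha>"
  unfolding redirect_class_def by (rule equiv_class_self[OF equiv_redirect_equiv])

lemma redirect_poset_eq: "redirect_poset x0 = redirect_class x0 ` qg_rays x0"
  by (auto simp: redirect_poset_def redirect_class_def quotient_def)

text \<open>Transitivity along \<open>\<alpha>\<close>, \<open>\<alpha>1\<close>,
  \<open>\<beta>1\<close>, \<open>\<beta>\<close> moves the relation from the representatives that
  witness it to the given ones.\<close>

lemma class_le_redirect_class_iff:
  assumes "\<alpha> \<in> qg_rays x0" "\<beta> \<in> qg_rays x0"
  shows "class_le x0 (redirect_class x0 \<alpha>) (redirect_class x0 \<beta>) \<longleftrightarrow> redirects x0 \<alpha> \<beta>"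
proof
  assume "class_le x0 (redirect_class x0 \<alpha>) (redirect_class x0 \<beta>)"
  then obtain \<alpha>1 \<beta>1 where "\<alpha>1 \<in> qg_rays x0" "\<beta>1 \<in> qg_rays x0"
    "redirects x0 \<alpha> \<alpha>1" "redirects x0 \<alpha>1 \<beta>1" "redirects x0 \<beta>1 \<beta>"
    by (auto simp: class_le_def redirect_class_def redirect_equiv_def)
  then show "redirects x0 \<alpha> \<beta>" using assms redirects_trans by meson
next
  assume "redirects x0 \<alpha> \<beta>"
  then show "class_le x0 (redirect_class x0 \<alpha>) (redirect_class x0 \<beta>)"
    using assms redirect_class_self by (auto simp: class_le_def)
qed

section \<open>Quasi-isometric embeddings and redirection\<close>

text \<open>The constants are parameters so that bounds uniform in the radius can be expressed
  through them.\<close>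

definition qi_embedding :: "real \<Rightarrow> real \<Rightarrow> ('a::metric_space \<Rightarrow> 'b::metric_space) \<Rightarrow> bool" where
  "qi_embedding k K \<Phi> \<longleftrightarrow> 1 \<le> k \<and> 0 \<le> K \<and>
     (\<forall>x x'. 1 / k * dist x x' - K \<le> dist (\<Phi> x) (\<Phi> x') \<and> dist (\<Phi> x) (\<Phi> x') \<le> k * dist x x' + K)"

lemma qi_embedding_close:
  fixes \<Phi> :: "'a::metric_space \<Rightarrow> 'b::metric_space"
  assumes "qi_embedding k K \<Phi>" "dist x x' \<le> D"
  shows "dist (\<Phi> x) (\<Phi> x') \<le> k * D + K"
proof -
  have "dist (\<Phi> x) (\<Phi> x') \<le> k * dist x x' + K" using assms(1) by (simp add: qi_embedding_def)
  also have "\<dots> \<le> k * D + K"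
    using assms by (intro add_right_mono mult_left_mono) (auto simp: qi_embedding_def)
  finally show ?thesis .
qed

text \<open>The lower bound passes from \<open>\<gamma>\<close> through \<open>\<Phi>\<close> to
  \<open>\<eta>\<close> at the cost of \<open>K\<close> and \<open>D\<close> at either end; the
  upper bound is the Lipschitz condition. Only \<open>L\<close> and \<open>D\<close> matter about
  \<open>\<eta>\<close>, which makes the constants uniform later.\<close>

lemma q_ray_near_qi_image:
  fixes \<Phi> :: "'a::metric_space \<Rightarrow> 'b::metric_space"
  assumes \<Phi>: "qi_embedding k K \<Phi>" and \<gamma>: "q_ray x0 q Q \<gamma>"
    and lip: "L-lipschitz_on {0..} \<eta>" and 0: "\<eta> 0 = y0" and "0 \<le> D"
    and near: "\<And>t. 0 \<le> t \<Longrightarrow> dist (\<eta> t) (\<Phi> (\<gamma> t)) \<le> D"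
  shows "q_ray y0 (k * q + L) (Q + K + 2 * D) \<eta>"
proof -
  have k: "1 \<le> k" "0 \<le> K" using \<Phi> by (auto simp: qi_embedding_def)
  have q: "1 \<le> q" "0 \<le> Q" using \<gamma> by (auto simp: q_ray_iff)
  have L: "0 \<le> L" using lip by (rule lipschitz_on_nonneg)
  have kq: "1 \<le> k * q" using mult_mono[of 1 k 1 q] k q by simp
  have "(t - s) / (k * q + L) - (Q + K + 2 * D) \<le> dist (\<eta> s) (\<eta> t)" if st: "0 \<le> s" "s \<le> t" for s t
  proof -
    have "(t - s) / q - Q \<le> dist (\<gamma> s) (\<gamma> t)" using \<gamma> st by (simp add: q_ray_iff)
    then have "1 / k * ((t - s) / q - Q) \<le> 1 / k * dist (\<gamma> s) (\<gamma> t)"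
      using k by (intro mult_left_mono) auto
    moreover have "1 / k * dist (\<gamma> s) (\<gamma> t) - K \<le> dist (\<Phi> (\<gamma> s)) (\<Phi> (\<gamma> t))"
      using \<Phi> by (simp add: qi_embedding_def)
    moreover have "dist (\<Phi> (\<gamma> s)) (\<Phi> (\<gamma> t)) \<le> D + (dist (\<eta> s) (\<eta> t) + D)"
      using near[of s] near[of t] st dist_triangle[of "\<Phi> (\<gamma> s)" "\<Phi> (\<gamma> t)" "\<eta> s"]
        dist_triangle[of "\<eta> s" "\<Phi> (\<gamma> t)" "\<eta> t"]
      by (simp add: dist_commute)
    moreover have "1 / k * ((t - s) / q - Q) = (t - s) / (k * q) - Q / k"
      by (simp add: algebra_simps diff_divide_distrib)
    moreover have "(t - s) / (k * q + L) \<le> (t - s) / (k * q)"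
      using kq L st by (intro divide_left_mono) auto
    moreover have "Q / k \<le> Q" using k q by (simp add: divide_le_eq mult_left_le mult_le_cancel_left1)
    ultimately show ?thesis by linarith
  qed
  moreover have "(k * q + L)-lipschitz_on {0..} \<eta>"
    using kq by (intro lipschitz_on_le[OF lip]) simp
  ultimately show ?thesis
    using kq L k q 0 \<open>0 \<le> D\<close> by (auto simp: q_ray_iff)
qed

text \<open>The composite of \<open>\<Phi>\<close> and \<open>\<gamma>\<close> is coarsely Lipschitz
  with constants \<open>k * q\<close> and \<open>K\<close>, so the error is the same for all
  \<open>\<gamma>\<close> with the same \<open>q\<close>.\<close>

lemma qi_image_approx:
  fixes \<Phi> :: "'a::metric_space \<Rightarrow> 'b::metric_space"
  assumes geo: "geodesic_space (UNIV :: 'b set)"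
    and \<Phi>: "qi_embedding k K \<Phi>" and \<gamma>: "q_ray x0 q Q \<gamma>"
  obtains \<eta> where "\<eta> 0 = \<Phi> x0" "(k * q + K)-lipschitz_on {0..} \<eta>"
    "\<And>t. 0 \<le> t \<Longrightarrow> dist (\<eta> t) (\<Phi> (\<gamma> t)) \<le> 2 * (k * q + K)"
proof -
  have k: "1 \<le> k" "0 \<le> K" using \<Phi> by (auto simp: qi_embedding_def)
  have q: "1 \<le> q" using \<gamma> by (auto simp: q_ray_iff)
  have "dist (\<Phi> (\<gamma> s)) (\<Phi> (\<gamma> t)) \<le> (k * q) * \<bar>s - t\<bar> + K" if "0 \<le> s" "0 \<le> t" for s t
  proof -
    have "dist (\<gamma> s) (\<gamma> t) \<le> q * \<bar>s - t\<bar>"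
      using \<gamma> that by (auto simp: q_ray_iff lipschitz_on_def dist_real_def)
    from qi_embedding_close[OF \<Phi> this] show ?thesis by (simp add: mult.assoc)
  qed
  then obtain \<eta> where "\<eta> 0 = \<Phi> (\<gamma> 0)" "(k * q + K)-lipschitz_on {0..} \<eta>"
    "\<And>t. 0 \<le> t \<Longrightarrow> dist (\<eta> t) (\<Phi> (\<gamma> t)) \<le> 2 * (k * q + K)"
    using coarse_lipschitz_approx[OF geo, of "\<lambda>t. \<Phi> (\<gamma> t)" "k * q" K] k q by auto
  then show thesis using that \<gamma> by (auto simp: q_ray_iff)
qed

lemma taming_exists:
  fixes \<Phi> :: "'a::metric_space \<Rightarrow> 'b::metric_space"
  assumes "geodesic_space (UNIV :: 'b set)" "qi_embedding k K \<Phi>" "\<alpha> \<in> qg_rays x0"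
  shows "\<exists>\<alpha>'. taming (\<Phi> x0) \<Phi> \<alpha> \<alpha>'"
proof -
  obtain q Q where \<alpha>: "q_ray x0 q Q \<alpha>" using assms(3) by (auto simp: qg_rays_def)
  obtain \<eta> where \<eta>: "\<eta> 0 = \<Phi> x0" "(k * q + K)-lipschitz_on {0..} \<eta>"
    "\<And>t. 0 \<le> t \<Longrightarrow> dist (\<eta> t) (\<Phi> (\<alpha> t)) \<le> 2 * (k * q + K)"
    using qi_image_approx[OF assms(1,2) \<alpha>] by blast
  have "0 \<le> 2 * (k * q + K)" using lipschitz_on_nonneg[OF \<eta>(2)] by simp
  from q_ray_near_qi_image[OF assms(2) \<alpha> \<eta>(2,1) this \<eta>(3)]
  have "\<eta> \<in> qg_rays (\<Phi> x0)" by (auto simp: qg_rays_def)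
  then show ?thesis using \<eta>(3) by (auto simp: taming_def bdd_above_def)
qed

lemma tamingE:
  assumes "taming y0 \<Phi> \<alpha> \<alpha>'"
  obtains q Q C where "q_ray y0 q Q \<alpha>'" "0 \<le> C" "\<And>t. 0 \<le> t \<Longrightarrow> dist (\<alpha>' t) (\<Phi> (\<alpha> t)) \<le> C"
proof -
  obtain q Q where "q_ray y0 q Q \<alpha>'" using assms by (auto simp: taming_def qg_rays_def)
  moreover obtain C where C: "\<And>t. 0 \<le> t \<Longrightarrow> dist (\<alpha>' t) (\<Phi> (\<alpha> t)) \<le> C"
    using assms unfolding taming_def bdd_above_def by fastforce
  moreover have "0 \<le> C" using order_trans[OF zero_le_dist C[of 0]] by simp
  ultimately show thesis using that by blast
qed

text \<open>Both transitions are short because the two pieces to be joined are close to the same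
  point of the image of \<open>\<gamma>\<close>.\<close>

lemma redirects_transfer:
  fixes \<Phi> :: "'a::metric_space \<Rightarrow> 'b::metric_space"
  assumes geo: "geodesic_space (UNIV :: 'b set)" and \<Phi>: "qi_embedding k K \<Phi>"
    and "\<alpha> \<in> qg_rays x0" "redirects x0 \<alpha> \<beta>"
    and "taming y0 \<Phi> \<alpha> \<alpha>'" "taming y0 \<Phi> \<beta> \<beta>'"
  shows "redirects y0 \<alpha>' \<beta>'"
proof -
  obtain qa Qa where \<alpha>: "q_ray x0 qa Qa \<alpha>" using assms(3) by (auto simp: qg_rays_def)
  obtain qa' Qa' Ca where \<alpha>': "q_ray y0 qa' Qa' \<alpha>'" and Ca: "0 \<le> Ca"
    and a_near: "\<And>t. 0 \<le> t \<Longrightarrow> dist (\<alpha>' t) (\<Phi> (\<alpha> t)) \<le> Ca"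
    using tamingE[OF assms(5)] by blast
  obtain qb' Qb' Cb where \<beta>': "q_ray y0 qb' Qb' \<beta>'" and Cb: "0 \<le> Cb"
    and b_near: "\<And>t. 0 \<le> t \<Longrightarrow> dist (\<beta>' t) (\<Phi> (\<beta> t)) \<le> Cb"
    using tamingE[OF assms(6)] by blast
  obtain q Q where q: "1 \<le> q" "0 \<le> Q" and red: "\<And>r. 0 < r \<Longrightarrow> redirectable x0 q Q r \<alpha> \<beta>"
    using assms(4) by (auto simp: redirects_def)
  have k: "1 \<le> k" "0 \<le> K" using \<Phi> by (auto simp: qi_embedding_def)
  \<comment> \<open>All constants are fixed before the radius. \<open>C\<close> is the error of the
    path \<open>\<gamma>'\<close> that approximates the image of \<open>\<gamma>\<close>,
    \<open>L\<close> a common Lipschitz constant of the three pieces, \<open>L1\<close> and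
    \<open>L2\<close> the constants after the first and second splice, and \<open>D\<close>
    dominates the errors on all stretches.\<close>
  define C where "C = 2 * (k * q + K)"
  define L where "L = qa' + qb' + (k * q + K)"
  define L1 where "L1 = L + (Ca + C)"
  define L2 where "L2 = L1 + (C + Cb)"
  define D where "D = 2 * L2 + C + Cb + Ca + C"
  have C: "0 \<le> C" using k q by (simp add: C_def)
  have L: "qa' \<le> L" "qb' \<le> L" "k * q + K \<le> L" "0 \<le> L"
    using \<alpha>' \<beta>' k q by (auto simp: L_def q_ray_iff)
  have L1: "L \<le> L1" "L1 \<le> L2" using C Ca Cb by (auto simp: L1_def L2_def)
  have D: "0 \<le> D" "Ca \<le> D" "C \<le> D" "2 * L + (Ca + C) + C \<le> D" "2 * L1 + (C + Cb) + Cb \<le> D" "Cb \<le> D"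
    using L L1 C Ca Cb by (auto simp: D_def L1_def L2_def)
  define q' where "q' = k * q + L2"
  define Q' where "Q' = Q + K + 2 * D"
  have "redirectable y0 q' Q' r \<alpha>' \<beta>'" if "0 < r" for r
  proof -
    define T where "T = first_time y0 \<alpha>' r"
    have T: "0 \<le> T" using first_time(1)[OF \<alpha>'] by (simp add: T_def)
    \<comment> \<open>The radius \<open>r\<close> in the target fixes the time \<open>T\<close>;
      this radius in the source makes \<open>\<gamma>\<close> follow \<open>\<alpha>\<close> up to
      that time.\<close>
    have "0 < qa * T + 1" using T \<alpha> by (intro add_nonneg_pos mult_nonneg_nonneg) (auto simp: q_ray_iff)
    then obtain \<gamma> t0 b where \<gamma>: "q_ray x0 q Q \<gamma>" "same_upto x0 (qa * T + 1) \<gamma> \<alpha>"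
      and t0: "0 < t0" "0 \<le> t0 + b" and \<gamma>\<beta>: "\<And>t. t0 \<le> t \<Longrightarrow> \<gamma> t = \<beta> (t + b)"
      using red unfolding redirectable_def eventually_coincides_def by metis
    have \<gamma>\<alpha>: "\<gamma> t = \<alpha> t" if "0 \<le> t" "t \<le> T" for t
    proof -
      have "qa * t \<le> qa * T" using that \<alpha> by (intro mult_left_mono) (auto simp: q_ray_iff)
      then show ?thesis using that by (intro same_uptoD[OF \<alpha> \<gamma>(2)]) auto
    qed
    \<comment> \<open>The second splice starts once \<open>\<gamma>\<close> runs along
      \<open>\<beta>\<close> and the first splice, of duration 1, is over.\<close>
    define S where "S = max t0 (T + 1)"
    have S: "t0 \<le> S" "T + 1 \<le> S" "0 \<le> S + b" "0 < S" using t0 by (auto simp: S_def)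
    obtain \<gamma>' where \<gamma>': "(k * q + K)-lipschitz_on {0..} \<gamma>'"
      and g_near: "\<And>t. 0 \<le> t \<Longrightarrow> dist (\<gamma>' t) (\<Phi> (\<gamma> t)) \<le> C"
      using qi_image_approx[OF geo \<Phi> \<gamma>(1)] unfolding C_def by blast
    have join1: "L-lipschitz_on {0..T} \<alpha>'"
      using \<alpha>' L by (auto simp: q_ray_iff intro: lipschitz_on_subset lipschitz_on_le)
    have join2: "L-lipschitz_on {T..} \<gamma>'"
      using lipschitz_on_subset[OF lipschitz_on_le[OF \<gamma>' L(3)], of "{T..}"] T by auto
    have join3: "dist (\<alpha>' T) (\<gamma>' T) \<le> Ca + C"
      using a_near[OF T] g_near[OF T] \<gamma>\<alpha>[OF T order_refl]
        dist_triangle2[of "\<alpha>' T" "\<gamma>' T" "\<Phi> (\<alpha> T)"] by simp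
    obtain \<eta>1 where \<eta>1: "L1-lipschitz_on {0..} \<eta>1"
      "\<And>t. t \<le> T \<Longrightarrow> \<eta>1 t = \<alpha>' t" "\<And>t. T + 1 \<le> t \<Longrightarrow> \<eta>1 t = \<gamma>' t"
      "\<And>t. t \<in> {T..T+1} \<Longrightarrow> dist (\<eta>1 t) (\<gamma>' t) \<le> 2 * L + (Ca + C)"
      using lipschitz_splice[OF geo join1 join2 join3 T, folded L1_def] by blast
    have bb_near: "dist (\<beta>' (t + b)) (\<Phi> (\<gamma> t)) \<le> Cb" if "S \<le> t" for t
      using that S \<gamma>\<beta>[of t] b_near[of "t + b"] by simp
    have join1: "L1-lipschitz_on {0..S} \<eta>1" by (rule lipschitz_on_subset[OF \<eta>1(1)]) auto
    have join2: "L1-lipschitz_on {S..} (\<lambda>t. \<beta>' (t + b))"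
    proof -
      have "L1-lipschitz_on {0..} \<beta>'"
        using \<beta>' L L1 by (auto simp: q_ray_iff intro: lipschitz_on_le)
      then show ?thesis by (rule lipschitz_on_shift) (use S(3) in simp)
    qed
    have join3: "dist (\<eta>1 S) (\<beta>' (S + b)) \<le> C + Cb"
      using g_near[of S] bb_near[of S] \<eta>1(3)[of S] S
        dist_triangle2[of "\<gamma>' S" "\<beta>' (S + b)" "\<Phi> (\<gamma> S)"] by simp
    obtain \<eta> where \<eta>: "L2-lipschitz_on {0..} \<eta>"
      "\<And>t. t \<le> S \<Longrightarrow> \<eta> t = \<eta>1 t" "\<And>t. S + 1 \<le> t \<Longrightarrow> \<eta> t = \<beta>' (t + b)"
      "\<And>t. t \<in> {S..S+1} \<Longrightarrow> dist (\<eta> t) (\<beta>' (t + b)) \<le> 2 * L1 + (C + Cb)"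
      using lipschitz_splice[OF geo join1 join2 join3 less_imp_le[OF S(4)], folded L2_def] by blast
    have near: "dist (\<eta> t) (\<Phi> (\<gamma> t)) \<le> D" if t: "0 \<le> t" for t
    proof -
      \<comment> \<open>The stretches are \<open>\<alpha>'\<close>, a bridge,
        \<open>\<gamma>'\<close>, a bridge, and the shifted \<open>\<beta>'\<close>; each bridge is
        compared with the piece it leads to.\<close>
      consider "t \<le> T" | "T \<le> t" "t \<le> T + 1" | "T + 1 \<le> t" "t \<le> S" | "S \<le> t" "t \<le> S + 1" | "S + 1 \<le> t"
        by linarith
      then show ?thesis
      proof cases
        case 1
        then show ?thesis
          using a_near[OF t] \<gamma>\<alpha>[OF t] \<eta>(2)[of t] \<eta>1(2)[of t] S D by simp
      next
        case 2
        then show ?thesis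
          using g_near[OF t] \<eta>(2)[of t] \<eta>1(4)[of t] S D dist_triangle[of "\<eta>1 t" "\<Phi> (\<gamma> t)" "\<gamma>' t"] by simp
      next
        case 3
        then show ?thesis
          using g_near[OF t] \<eta>(2)[of t] \<eta>1(3)[of t] D by simp
      next
        case 4
        then show ?thesis
          using bb_near[of t] \<eta>(4)[of t] D dist_triangle[of "\<eta> t" "\<Phi> (\<gamma> t)" "\<beta>' (t + b)"] by simp
      next
        case 5
        then show ?thesis using bb_near[of t] \<eta>(3)[of t] D by simp
      qed
    qed
    have pre: "\<eta> t = \<alpha>' t" if "t \<le> T" for t
      using that \<eta>(2)[of t] \<eta>1(2)[of t] S by simp
    have "\<eta> 0 = y0" using pre[OF T] \<alpha>' by (simp add: q_ray_iff)
    from q_ray_near_qi_image[OF \<Phi> \<gamma>(1) \<eta>(1) this D(1) near]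
    have "q_ray y0 q' Q' \<eta>" by (simp add: q'_def Q'_def)
    moreover have "same_upto y0 r \<eta> \<alpha>'"
      by (rule same_uptoI[OF \<alpha>', of T]) (auto simp: pre T_def)
    moreover have "eventually_coincides \<eta> \<beta>'"
    proof -
      have "0 < S + 1" "0 \<le> (S + 1) + b" using S by auto
      then show ?thesis using \<eta>(3) unfolding eventually_coincides_def by blast
    qed
    ultimately show ?thesis unfolding redirectable_def by blast
  qed
  \<comment> \<open>A ray at any one radius, here 1, carries the bounds on its constants.\<close>
  moreover from this[of 1] have "1 \<le> q'" "0 \<le> Q'" by (auto simp: redirectable_def q_ray_iff)
  ultimately show ?thesis unfolding redirects_def by blast
qed

section \<open>Quasi-inverses\<close>

text \<open>Choosing near-preimages changes distances by at most \<open>2 * K\<close> after applying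
  \<open>\<Phi>\<close>; the lower bound of \<open>\<Phi>\<close> adds another \<open>K\<close> and
  the factor \<open>k\<close>, whence \<open>3 * k * K\<close>.\<close>

lemma quasi_isometry_quasi_inverse:
  fixes \<Phi> :: "'a::metric_space \<Rightarrow> 'b::metric_space"
  assumes "quasi_isometry \<Phi>"
  obtains k K \<Psi> k' K' where "qi_embedding k K \<Phi>" "qi_embedding k' K' \<Psi>" "\<Psi> (\<Phi> x0) = x0"
    "\<And>y. dist y (\<Phi> (\<Psi> y)) \<le> K" "\<And>x. dist x (\<Psi> (\<Phi> x)) \<le> K'"
proof -
  obtain k K where \<Phi>: "qi_embedding k K \<Phi>" and onto: "\<And>y. \<exists>x. dist y (\<Phi> x) \<le> K"
    using assms by (auto simp: quasi_isometry_def qi_embedding_def)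
  have k: "1 \<le> k" "0 \<le> K" using \<Phi> by (auto simp: qi_embedding_def)
  \<comment> \<open>The value at \<open>\<Phi> x0\<close> is forced so that base points correspond
    exactly, as rays must start there.\<close>
  define \<Psi> where "\<Psi> = (\<lambda>y. if y = \<Phi> x0 then x0 else SOME x. dist y (\<Phi> x) \<le> K)"
  have \<Psi>: "dist y (\<Phi> (\<Psi> y)) \<le> K" for y
    using someI_ex[OF onto[of y]] k by (auto simp: \<Psi>_def)
  have up: "dist x x' \<le> k * (dist (\<Phi> x) (\<Phi> x') + K)" for x x'
  proof -
    have "1 / k * dist x x' \<le> dist (\<Phi> x) (\<Phi> x') + K"
      using \<Phi> by (simp add: qi_embedding_def diff_le_eq)
    then show ?thesis using k by (simp add: field_simps)
  qed
  have "qi_embedding k (3 * k * K) \<Psi>"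
    unfolding qi_embedding_def
  proof (intro conjI allI)
    show "1 \<le> k" "0 \<le> 3 * k * K" using k by auto
    fix y y'
    have "dist (\<Phi> (\<Psi> y)) (\<Phi> (\<Psi> y')) \<le> dist y y' + 2 * K"
      using \<Psi>[of y] \<Psi>[of y'] dist_triangle[of "\<Phi> (\<Psi> y)" "\<Phi> (\<Psi> y')" y]
        dist_triangle[of y "\<Phi> (\<Psi> y')" y'] by (simp add: dist_commute)
    then have "k * (dist (\<Phi> (\<Psi> y)) (\<Phi> (\<Psi> y')) + K) \<le> k * (dist y y' + 2 * K + K)"
      using k by (intro mult_left_mono) auto
    with up[of "\<Psi> y" "\<Psi> y'"] show "dist (\<Psi> y) (\<Psi> y') \<le> k * dist y y' + 3 * k * K"
      by (simp add: algebra_simps)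
    have "dist y y' \<le> dist (\<Phi> (\<Psi> y)) (\<Phi> (\<Psi> y')) + 2 * K"
      using \<Psi>[of y] \<Psi>[of y'] dist_triangle[of y y' "\<Phi> (\<Psi> y)"]
        dist_triangle[of "\<Phi> (\<Psi> y)" y' "\<Phi> (\<Psi> y')"] by (simp add: dist_commute)
    also have "\<dots> \<le> k * dist (\<Psi> y) (\<Psi> y') + 3 * K"
      using qi_embedding_close[OF \<Phi> order_refl, of "\<Psi> y" "\<Psi> y'"] by simp
    \<comment> \<open>As k \<ge> 1, the error \<open>3 * K\<close> still fits under
      \<open>3 * k * K\<close> after division by \<open>k\<close>.\<close>
    also have "3 * K \<le> k * (3 * k * K)"
    proof -
      have "1 * 1 \<le> k * k" using k by (intro mult_mono) auto
      then have "1 * (3 * K) \<le> (k * k) * (3 * K)" using k by (intro mult_right_mono) auto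
      then show ?thesis by (simp add: ac_simps)
    qed
    finally have "dist y y' \<le> k * (dist (\<Psi> y) (\<Psi> y') + 3 * k * K)"
      by (simp add: distrib_left)
    then show "1 / k * dist y y' - 3 * k * K \<le> dist (\<Psi> y) (\<Psi> y')"
      using k by (simp add: field_simps)
  qed
  moreover have "dist x (\<Psi> (\<Phi> x)) \<le> 3 * k * K" for x
  proof -
    have "k * (dist (\<Phi> x) (\<Phi> (\<Psi> (\<Phi> x))) + K) \<le> k * (K + K)"
      using k \<Psi>[of "\<Phi> x"] by (intro mult_left_mono) auto
    moreover have "k * (K + K) \<le> 3 * k * K" using k by simp
    ultimately show ?thesis using up[of x "\<Psi> (\<Phi> x)"] by linarith
  qed
  ultimately show thesis using that[OF \<Phi>] \<Psi> by (auto simp: \<Psi>_def)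
qed

text \<open>Applying \<open>\<Psi>\<close> keeps the two paths a bounded distance apart and moves
  the image of \<open>\<alpha>\<close> back near \<open>\<alpha>\<close>. Thus taming becomes
  symmetric between a map and its quasi-inverse.\<close>

lemma taming_quasi_inverse:
  fixes \<Phi> :: "'a::metric_space \<Rightarrow> 'b::metric_space"
  assumes \<Psi>: "qi_embedding k' K' \<Psi>" and inv: "\<And>x. dist x (\<Psi> (\<Phi> x)) \<le> D"
    and "\<alpha> \<in> qg_rays x0" "taming y0 \<Phi> \<alpha> \<alpha>'"
  shows "taming x0 \<Psi> \<alpha>' \<alpha>"
proof -
  obtain C where C: "\<And>t. 0 \<le> t \<Longrightarrow> dist (\<alpha>' t) (\<Phi> (\<alpha> t)) \<le> C"
    using tamingE[OF assms(4)] by blast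
  have "dist (\<alpha> t) (\<Psi> (\<alpha>' t)) \<le> D + (k' * C + K')" if "0 \<le> t" for t
    using dist_triangle2[of "\<alpha> t" "\<Psi> (\<alpha>' t)" "\<Psi> (\<Phi> (\<alpha> t))"] inv[of "\<alpha> t"]
      qi_embedding_close[OF \<Psi> C[OF that]] by linarith
  then show ?thesis using assms(3) by (auto simp: taming_def bdd_above_def)
qed

section \<open>The induced map on equivalence classes\<close>

theorem proposition1:
  fixes x0 :: "'a::heine_borel" and y0 :: "'b::heine_borel" and \<Phi> :: "'a \<Rightarrow> 'b"
  assumes "geodesic_space (UNIV :: 'a set)" and "geodesic_space (UNIV :: 'b set)"
    and "quasi_isometry \<Phi>" and "\<Phi> x0 = y0"
  shows "(\<forall>\<alpha>\<in>qg_rays x0. (\<exists>\<alpha>'. taming y0 \<Phi> \<alpha> \<alpha>') \<and>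
            (\<forall>\<alpha>'. taming y0 \<Phi> \<alpha> \<alpha>' \<longrightarrow>
               induced_map y0 \<Phi> (redirect_class x0 \<alpha>) = redirect_class y0 \<alpha>')) \<and>
         bij_betw (induced_map y0 \<Phi>) (redirect_poset x0) (redirect_poset y0) \<and>
         (\<forall>A\<in>redirect_poset x0. \<forall>B\<in>redirect_poset x0.
            class_le x0 A B \<longleftrightarrow> class_le y0 (induced_map y0 \<Phi> A) (induced_map y0 \<Phi> B))"
proof -
  obtain k K \<Psi> k' K' where \<Phi>: "qi_embedding k K \<Phi>" and \<Psi>: "qi_embedding k' K' \<Psi>"
    and base: "\<Psi> y0 = x0"
    and inv: "\<And>y. dist y (\<Phi> (\<Psi> y)) \<le> K" "\<And>x. dist x (\<Psi> (\<Phi> x)) \<le> K'"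
    using quasi_isometry_quasi_inverse[OF assms(3), of x0] assms(4) by metis
  have ex: "\<exists>\<alpha>'. taming y0 \<Phi> \<alpha> \<alpha>'" if "\<alpha> \<in> qg_rays x0" for \<alpha>
    using taming_exists[OF assms(2) \<Phi> that] assms(4) by simp
  \<comment> \<open>A taming of the image of \<open>\<beta>\<close> under \<open>\<Psi>\<close> is a
    preimage, by the symmetry of taming with the two maps exchanged.\<close>
  have surj: "\<exists>\<alpha>\<in>qg_rays x0. taming y0 \<Phi> \<alpha> \<beta>" if \<beta>: "\<beta> \<in> qg_rays y0" for \<beta>
  proof -
    obtain \<alpha> where \<alpha>: "taming x0 \<Psi> \<beta> \<alpha>" using taming_exists[OF assms(1) \<Psi> \<beta>] base by auto
    then have "taming y0 \<Phi> \<alpha> \<beta>" using taming_quasi_inverse[OF \<Phi> inv(1) \<beta>] by blast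
    then show ?thesis using \<alpha> by (auto simp: taming_def)
  qed
  have rays: "\<alpha>' \<in> qg_rays y0" if "taming y0 \<Phi> \<alpha> \<alpha>'" for \<alpha> \<alpha>'
    using that by (simp add: taming_def)
  \<comment> \<open>The converse is the transfer along \<open>\<Psi>\<close>, for which
    \<open>\<alpha>\<close> and \<open>\<beta>\<close> are tamings of the images of
    \<open>\<alpha>'\<close> and \<open>\<beta>'\<close>.\<close>
  have iff: "redirects x0 \<alpha> \<beta> \<longleftrightarrow> redirects y0 \<alpha>' \<beta>'"
    if "\<alpha> \<in> qg_rays x0" "\<beta> \<in> qg_rays x0" "taming y0 \<Phi> \<alpha> \<alpha>'" "taming y0 \<Phi> \<beta> \<beta>'" for \<alpha> \<beta> \<alpha>' \<beta>'
    using that redirects_transfer[OF assms(2) \<Phi>, of \<alpha> x0 \<beta> y0 \<alpha>' \<beta>']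
      redirects_transfer[OF assms(1) \<Psi>, of \<alpha>' y0 \<beta>' x0 \<alpha> \<beta>]
      taming_quasi_inverse[OF \<Psi> inv(2)] rays by blast
  have ind: "induced_map y0 \<Phi> (redirect_class x0 \<alpha>) = redirect_class y0 \<alpha>'"
    if \<alpha>: "\<alpha> \<in> qg_rays x0" and \<alpha>': "taming y0 \<Phi> \<alpha> \<alpha>'" for \<alpha> \<alpha>'
    unfolding induced_map_def
  proof (rule the_equality)
    show "\<exists>\<alpha>1\<in>redirect_class x0 \<alpha>. \<exists>\<alpha>1'. taming y0 \<Phi> \<alpha>1 \<alpha>1' \<and>
        redirect_class y0 \<alpha>' = redirect_class y0 \<alpha>1'"
      using redirect_class_self[OF \<alpha>] \<alpha>' by blast
  next
    fix B assume "\<exists>\<alpha>1\<in>redirect_class x0 \<alpha>. \<exists>\<alpha>1'. taming y0 \<Phi> \<alpha>1 \<alpha>1' \<and> B = redirect_class y0 \<alpha>1'"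
    then obtain \<alpha>1 \<alpha>1' where 1: "\<alpha>1 \<in> redirect_class x0 \<alpha>" "taming y0 \<Phi> \<alpha>1 \<alpha>1'"
      and B: "B = redirect_class y0 \<alpha>1'" by blast
    from 1(1) have "\<alpha>1 \<in> qg_rays x0" "redirects x0 \<alpha> \<alpha>1" "redirects x0 \<alpha>1 \<alpha>"
      by (auto simp: redirect_class_def redirect_equiv_def)
    \<comment> \<open>By \<open>iff\<close>, tamings of equivalent rays are equivalent; this settles
      independence of the representative and of the taming at once.\<close>
    then show "B = redirect_class y0 \<alpha>'"
      unfolding B using redirect_class_eq_iff[of \<alpha>1' y0 \<alpha>'] iff 1(2) \<alpha> \<alpha>' rays by blast
  qed
  have ex_rep: "\<exists>\<alpha> \<alpha>'. \<alpha> \<in> qg_rays x0 \<and> taming y0 \<Phi> \<alpha> \<alpha>' \<and> A = redirect_class x0 \<alpha> \<and>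
      induced_map y0 \<Phi> A = redirect_class y0 \<alpha>'" if "A \<in> redirect_poset x0" for A
    using that ex ind unfolding redirect_poset_eq by blast
  have "inj_on (induced_map y0 \<Phi>) (redirect_poset x0)"
  proof (rule inj_onI)
    fix A B assume A: "A \<in> redirect_poset x0" and B: "B \<in> redirect_poset x0"
      and "induced_map y0 \<Phi> A = induced_map y0 \<Phi> B"
    then show "A = B"
      using ex_rep[OF A] ex_rep[OF B] iff redirect_class_eq_iff rays by metis
  qed
  moreover have "induced_map y0 \<Phi> ` redirect_poset x0 = redirect_poset y0"
  proof
    show "induced_map y0 \<Phi> ` redirect_poset x0 \<subseteq> redirect_poset y0"
      using ex_rep rays unfolding redirect_poset_eq[of y0] by blast
    show "redirect_poset y0 \<subseteq> induced_map y0 \<Phi> ` redirect_poset x0"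
      using surj ind unfolding redirect_poset_eq by (auto simp: image_iff) metis
  qed
  moreover have "class_le x0 A B \<longleftrightarrow> class_le y0 (induced_map y0 \<Phi> A) (induced_map y0 \<Phi> B)"
    if "A \<in> redirect_poset x0" "B \<in> redirect_poset x0" for A B
    using ex_rep[OF that(1)] ex_rep[OF that(2)] iff class_le_redirect_class_iff rays by metis
  ultimately show ?thesis using ex ind by (auto simp: bij_betw_def)
qed

end
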